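(* Let $T,I,J$ be positive integers, let $\mathcal{W}\subset\mathbb{R}^{IT}$ be a nonempty polytope, and let $\alpha^t,\beta^t$ ($t=1,\ldots,T$) be real numbers (purchase and selling prices). For $\{P_R^t\}=(P_R^t)_{t=1}^T\in\mathbb{R}^T$ and $\{P_{B_j}^t\}=(P_{B_j}^t)_{j=1,\ldots,J;\,t=1,\ldots,T}\in\mathbb{R}^{JT}$ define the worst-case transaction cost $$G(\{P_R^t\},\{P_{B_j}^t\}) := \max_{\mathbf{w}\in\mathcal{W}}\ \sum_{t=1}^T\Bigg(\alpha^t\Big[P_R^t-\sum_{i=1}^{I}W_i^t+\sum_{j=1}^{J}P_{B_j}^t\Big]^{+}-\beta^t\Big[P_R^t-\sum_{i=1}^{I}W_i^t+\sum_{j=1}^{J}P_{B_j}^t\Big]^{-}\Bigg),$$ where $\mathbf{w}=[W_1^1,\ldots,W_1^T,\ldots,W_I^1,\ldots,W_I^T]$. If $\beta^t\le\alpha^t$ for every $t\in\{1,\ldots,T\}$, then $G(\{P_R^t\},\{P_{B_j}^t\})$ is convex in $(\{P_R^t\},\{P_{B_j}^t\})$.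
   Context: Notation: $[a]^{+}:=\max\{a,0\}$ and $[a]^{-}:=\max\{-a,0\}$ for $a\in\mathbb{R}$. A polytope is a bounded set defined by finitely many linear inequalities. Interpretation: $W_i^t$ is the uncertain renewable energy of facility $i$ in slot $t$, $\mathcal{W}$ is the uncertainty set, $P_R^t$ is net power delivered to the microgrid, and $P_{B_j}^t$ is the charging (if positive) or discharging (if negative) power of storage unit $j$. Convexity is joint convexity as a function on $\mathbb{R}^T\times\mathbb{R}^{JT}$. *)

theory Defs
  imports "HOL-Analysis.Analysis"
begin

definition pos_part :: "real \<Rightarrow> real" where
  "pos_part a = max a 0"

definition neg_part :: "real \<Rightarrow> real" where
  "neg_part a = max (- a) 0"

(* Time slots are indexed by 't, renewable facilities by 'i and storage units by 'j, so that
   CARD('t), CARD('i), CARD('j) are the (arbitrary, positive) numbers T, I, J.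
   W_i^t is w $ i $ t and P_(B_j)^t is PB $ j $ t. *)

definition net_demand ::
  "real ^ 't \<Rightarrow> real ^ 't ^ 'j \<Rightarrow> real ^ 't ^ 'i \<Rightarrow> 't \<Rightarrow> real" where
  "net_demand PR PB w t = PR $ t - (\<Sum>i\<in>UNIV. w $ i $ t) + (\<Sum>j\<in>UNIV. PB $ j $ t)"

definition transaction_cost ::
  "real ^ 't \<Rightarrow> real ^ 't \<Rightarrow> real ^ 't \<Rightarrow> real ^ 't ^ 'j \<Rightarrow> real ^ 't ^ 'i \<Rightarrow> real" where
  "transaction_cost \<alpha> \<beta> PR PB w =
     (\<Sum>t\<in>UNIV. \<alpha> $ t * pos_part (net_demand PR PB w t)
              - \<beta> $ t * neg_part (net_demand PR PB w t))"

(* A genuine maximum: GREATEST returns the largest attained value, which exists whenever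
   the set of scenarios is nonempty and compact, and is unspecified if there is none. *)

definition worst_case_cost ::
  "(real ^ 't ^ 'i) set \<Rightarrow> real ^ 't \<Rightarrow> real ^ 't \<Rightarrow>
   (real ^ 't) \<times> (real ^ 't ^ 'j) \<Rightarrow> real" where
  "worst_case_cost W \<alpha> \<beta> =
     (\<lambda>(PR, PB). GREATEST c. c \<in> transaction_cost \<alpha> \<beta> PR PB ` W)"

end

theory Submission
  imports Defs
begin

text \<open>
  Since \<open>[a]\<^sup>+ - [a]\<^sup>- = a\<close>, each summand equals \<open>\<beta> a + (\<alpha> - \<beta>) [a]\<^sup>+\<close>, which is convex in
  \<open>a\<close> when \<open>\<beta> \<le> \<alpha>\<close>; the net demand is affine in the decision variables, so every scenario has a
  convex cost. The worst case is a pointwise maximum of these, attained because a bounded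
  polyhedron is compact.
\<close>

text \<open>The cost of one slot is a linear function plus a nonnegative multiple of
  \<open>max x 0\<close>, hence sublinear, so the weights need not sum to one here.\<close>

lemma price_convex:
  fixes a b p q u v :: real
  assumes "q \<le> p" "0 \<le> u" "0 \<le> v"
  shows "p * pos_part (u * a + v * b) - q * neg_part (u * a + v * b)
    \<le> u * (p * pos_part a - q * neg_part a) + v * (p * pos_part b - q * neg_part b)"
proof -
  have eq: "p * pos_part x - q * neg_part x = q * x + (p - q) * max x 0" for x
    by (auto simp: pos_part_def neg_part_def max_def algebra_simps)
  have "u * a \<le> u * max a 0" "v * b \<le> v * max b 0" "0 \<le> u * max a 0" "0 \<le> v * max b 0"
    using assms by (auto intro: mult_left_mono)
  then have "max (u * a + v * b) 0 \<le> u * max a 0 + v * max b 0"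
    by linarith
  then have "(p - q) * max (u * a + v * b) 0 \<le> (p - q) * (u * max a 0 + v * max b 0)"
    using assms by (intro mult_left_mono) auto
  then show ?thesis
    unfolding eq by (simp add: algebra_simps)
qed

lemma net_demand_affine:
  assumes "u + v = 1"
  shows "net_demand (u *\<^sub>R PR + v *\<^sub>R PR') (u *\<^sub>R PB + v *\<^sub>R PB') w t
    = u * net_demand PR PB w t + v * net_demand PR' PB' w t"
proof -
  let ?S = "\<Sum>i\<in>UNIV. w $ i $ t"
  \<comment> \<open>The renewable total does not depend on the decisions; it is the constant part of
    an affine map, and splitting it between the two points is where \<open>u + v = 1\<close>
    enters.\<close>
  have "?S = u * ?S + v * ?S"
    using assms by (metis distrib_right mult_1)
  then show ?thesis
    by (simp add: net_demand_def sum.distrib sum_distrib_left[symmetric] algebra_simps)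
qed

lemma transaction_cost_convex:
  assumes "\<forall>t. \<beta> $ t \<le> \<alpha> $ t" "0 \<le> u" "0 \<le> v" "u + v = 1"
  shows "transaction_cost \<alpha> \<beta> (u *\<^sub>R PR + v *\<^sub>R PR') (u *\<^sub>R PB + v *\<^sub>R PB') w
    \<le> u * transaction_cost \<alpha> \<beta> PR PB w + v * transaction_cost \<alpha> \<beta> PR' PB' w"
  \<comment> \<open>Moving the weights inside and merging the right side into one sum over slots
    leaves a termwise comparison.\<close>
  unfolding transaction_cost_def net_demand_affine[OF assms(4)] sum_distrib_left
    sum.distrib[symmetric]
  using assms by (intro sum_mono price_convex) auto

lemma continuous_on_transaction_cost:
  "continuous_on W (transaction_cost \<alpha> \<beta> PR PB)"
  unfolding transaction_cost_def[abs_def] net_demand_def pos_part_def neg_part_def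
  by (intro continuous_intros)

text \<open>\<open>GREATEST\<close> carries information only if a maximum exists; a continuous cost
  on a nonempty compact set has one. All later reasoning about the worst case goes through this
  lemma.\<close>

lemma worst_case_cost_attained:
  assumes "compact W" "W \<noteq> {}"
  obtains w where "w \<in> W" "worst_case_cost W \<alpha> \<beta> (PR, PB) = transaction_cost \<alpha> \<beta> PR PB w"
    "\<And>w'. w' \<in> W \<Longrightarrow> transaction_cost \<alpha> \<beta> PR PB w' \<le> worst_case_cost W \<alpha> \<beta> (PR, PB)"
proof -
  obtain w where w: "w \<in> W"
    "\<forall>w'\<in>W. transaction_cost \<alpha> \<beta> PR PB w' \<le> transaction_cost \<alpha> \<beta> PR PB w"
    using continuous_attains_sup[OF assms continuous_on_transaction_cost] by blast
  then have "worst_case_cost W \<alpha> \<beta> (PR, PB) = transaction_cost \<alpha> \<beta> PR PB w"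
    unfolding worst_case_cost_def by (auto intro!: Greatest_equality)
  with w that show ?thesis by simp
qed

theorem proposition1:
  fixes W :: "(real ^ 't ^ 'i) set"
    and \<alpha> \<beta> :: "real ^ 't"
  assumes "W \<noteq> {}"
    and "polyhedron W"
    and "bounded W"
    and "\<forall>t. \<beta> $ t \<le> \<alpha> $ t"
  shows "convex_on UNIV
    (worst_case_cost W \<alpha> \<beta> :: (real ^ 't) \<times> (real ^ 't ^ 'j) \<Rightarrow> real)"
proof -
  have "compact W"
    using assms by (simp add: compact_eq_bounded_closed polyhedron_imp_closed)
  note attained = worst_case_cost_attained[OF this \<open>W \<noteq> {}\<close>]
  let ?G = "worst_case_cost W \<alpha> \<beta> :: (real ^ 't) \<times> (real ^ 't ^ 'j) \<Rightarrow> real"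
  have "?G (u *\<^sub>R (PR, PB) + v *\<^sub>R (PR', PB')) \<le> u * ?G (PR, PB) + v * ?G (PR', PB')"
    if uv: "0 \<le> u" "0 \<le> v" "u + v = 1" for u v PR PB PR' PB'
  proof -
    \<comment> \<open>Take a worst scenario for the mixed decision and keep it fixed at both
      endpoints. It need not be worst there, but its cost is still at most the maximum.\<close>
    obtain w where "w \<in> W" and
      eq: "?G (u *\<^sub>R PR + v *\<^sub>R PR', u *\<^sub>R PB + v *\<^sub>R PB')
        = transaction_cost \<alpha> \<beta> (u *\<^sub>R PR + v *\<^sub>R PR') (u *\<^sub>R PB + v *\<^sub>R PB') w"
      by (rule attained)
    have le: "transaction_cost \<alpha> \<beta> PR PB w \<le> ?G (PR, PB)" for PR PB
      by (rule attained) (use \<open>w \<in> W\<close> in blast)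
    have "?G (u *\<^sub>R PR + v *\<^sub>R PR', u *\<^sub>R PB + v *\<^sub>R PB')
      \<le> u * transaction_cost \<alpha> \<beta> PR PB w + v * transaction_cost \<alpha> \<beta> PR' PB' w"
      unfolding eq using assms(4) uv by (rule transaction_cost_convex)
    also have "\<dots> \<le> u * ?G (PR, PB) + v * ?G (PR', PB')"
      using uv le by (intro add_mono mult_left_mono)
    finally show ?thesis by simp
  qed
  then show ?thesis
    by (auto simp: convex_on_def)
qed

end
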